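(* Let $\lambda>0$ and let $f=h+\overline{g}\in\mathcal{H}^0$ with $h(z)=z+\sum_{n=2}^\infty a_nz^n$ and $g(z)=\sum_{n=2}^\infty b_nz^n$. If $$\sum_{n=2}^\infty(n-1)\left(|a_n|+|b_n|\right)<\lambda,$$ then $f\in\Omega_{\mathcal{H}}^0(\lambda)$.
   Context: $\mathbb{D}=\{z\in\mathbb{C}:|z|<1\}$. $\mathcal{H}^0$ is the class of complex-valued harmonic functions $f=h+\overline{g}$ on $\mathbb{D}$, where $h,g$ are analytic on $\mathbb{D}$ with $h(z)=z+\sum_{n\ge2}a_nz^n$ and $g(z)=\sum_{n\ge2}b_nz^n$. For $\lambda>0$, $\Omega_{\mathcal{H}}^0(\lambda)$ is the set of $f=h+\overline{g}\in\mathcal{H}^0$ such that $|h(z)-zh'(z)|<\lambda-|g(z)-zg'(z)|$ for all $z\in\mathbb{D}$. *)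

theory Defs
  imports "HOL-Analysis.Analysis"
begin

text \<open>
  Functions on the open unit disc are total functions of which only the values on
  \<open>ball 0 1\<close> matter. A series over \<open>n \<ge> 2\<close> is written with its index shifted by 2, so
  \<open>a 0\<close>, \<open>a 1\<close>, \<open>b 0\<close>, \<open>b 1\<close> play no role.
\<close>

definition harmonic_rep ::
  "(complex \<Rightarrow> complex) \<Rightarrow> (complex \<Rightarrow> complex) \<Rightarrow> (complex \<Rightarrow> complex) \<Rightarrow>
   (nat \<Rightarrow> complex) \<Rightarrow> (nat \<Rightarrow> complex) \<Rightarrow> bool" where
  "harmonic_rep f h g a b \<longleftrightarrow>
     h analytic_on ball 0 1 \<and> g analytic_on ball 0 1 \<and>
     (\<forall>z\<in>ball 0 1. (\<lambda>n. a (n + 2) * z ^ (n + 2)) sums (h z - z)) \<and>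
     (\<forall>z\<in>ball 0 1. (\<lambda>n. b (n + 2) * z ^ (n + 2)) sums g z) \<and>
     (\<forall>z\<in>ball 0 1. f z = h z + cnj (g z))"

text \<open>
  Harmonicity is not a separate condition: the sum of an analytic function and the
  conjugate of an analytic function is harmonic.
\<close>

definition harmonic_H0 :: "(complex \<Rightarrow> complex) set" where
  "harmonic_H0 = {f. \<exists>h g a b. harmonic_rep f h g a b}"

text \<open>
  On the disc, \<open>h\<close> and \<open>g\<close> are determined by \<open>f\<close> (because \<open>g 0 = 0\<close>), so it does not
  matter that the decomposition is quantified existentially.
\<close>

definition Omega_H0 :: "real \<Rightarrow> (complex \<Rightarrow> complex) set" where
  "Omega_H0 l = {f \<in> harmonic_H0. \<exists>h g a b. harmonic_rep f h g a b \<and>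
     (\<forall>z\<in>ball 0 1. cmod (h z - z * deriv h z) < l - cmod (g z - z * deriv g z))}"

end

theory Submission
  imports Defs
begin

text \<open>
  The operator that sends \<open>\<phi>\<close> to \<open>z \<phi>' - \<phi>\<close> multiplies the \<open>n\<close>-th Taylor coefficient by
  \<open>n - 1\<close>. It therefore kills the linear term of \<open>h\<close>, and on the disc the triangle inequality
  bounds its values on \<open>h\<close> and \<open>g\<close> by the two halves of the coefficient sum.
\<close>

text \<open>A power series may be differentiated termwise inside the disc. Since
  \<open>\<phi>\<close> is only known to agree with the series there, the derivative is transferred
  to it through the open set \<open>ball 0 1\<close>, which contains \<open>z\<close>.\<close>

lemma power_series_has_field_derivative:
  fixes c :: "nat \<Rightarrow> complex"
  assumes sums: "\<And>w. w \<in> ball 0 1 \<Longrightarrow> (\<lambda>n. c n * w ^ n) sums \<phi> w"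
    and z: "z \<in> ball 0 1"
  shows "(\<phi> has_field_derivative (\<Sum>n. diffs c n * z ^ n)) (at z)"
proof -
  have "((\<lambda>w. \<Sum>n. c n * w ^ n) has_field_derivative (\<Sum>n. diffs c n * z ^ n)) (at z)"
    by (rule termdiffs_strong'[where K = 1]) (use sums z in \<open>auto simp: sums_iff\<close>)
  then show ?thesis
    by (rule has_field_derivative_transform_within_open[where S = "ball 0 1"])
      (use sums z in \<open>auto simp: sums_iff\<close>)
qed

lemma sums_times_deriv:
  fixes c :: "nat \<Rightarrow> complex"
  assumes sums: "\<And>w. w \<in> ball 0 1 \<Longrightarrow> (\<lambda>n. c n * w ^ n) sums \<phi> w"
    and z: "z \<in> ball 0 1"
  shows "(\<lambda>n. of_nat n * c n * z ^ n) sums (z * deriv \<phi> z)"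
proof -
  have "summable (\<lambda>n. diffs c n * z ^ n)"
    by (rule termdiff_converges[where K = 1]) (use sums z in \<open>auto simp: sums_iff\<close>)
  then have "(\<lambda>n. diffs c n * z ^ n) sums deriv \<phi> z"
    using DERIV_imp_deriv[OF power_series_has_field_derivative[OF sums z]]
    by (simp add: summable_sums)
  then have "(\<lambda>n. z * (diffs c n * z ^ n)) sums (z * deriv \<phi> z)"
    by (rule sums_mult)
  then have "(\<lambda>n. of_nat (Suc n) * c (Suc n) * z ^ Suc n) sums (z * deriv \<phi> z)"
    by (simp add: diffs_def mult_ac)
  \<comment> \<open>The index can be lowered by one without a correction: the term at 0 vanishes
    because of its factor \<open>of_nat 0\<close>.\<close>
  then show ?thesis
    by (subst (asm) sums_Suc_iff) simp
qed

lemma sums_times_deriv_minus: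
  fixes c :: "nat \<Rightarrow> complex"
  assumes sums: "\<And>w. w \<in> ball 0 1 \<Longrightarrow> (\<lambda>n. c (n + 2) * w ^ (n + 2)) sums \<phi> w"
    and z: "z \<in> ball 0 1"
  shows "(\<lambda>n. of_nat (n + 1) * c (n + 2) * z ^ (n + 2)) sums (z * deriv \<phi> z - \<phi> z)"
proof -
  \<comment> \<open>Padding with two zeros turns the shifted series into a full power series, to
    which termwise differentiation applies. The values \<open>c 0\<close> and \<open>c 1\<close> are
    arbitrary and must not enter.\<close>
  define d where "d n = (if n < 2 then 0 else c n)" for n
  have d: "(\<lambda>n. d n * w ^ n) sums \<phi> w" if "w \<in> ball 0 1" for w
    using sums[OF that] sums_iff_shift[of "\<lambda>n. d n * w ^ n" 2 "\<phi> w"]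
    by (simp add: d_def)
  have "(\<lambda>n. of_nat n * d n * z ^ n - d n * z ^ n) sums (z * deriv \<phi> z - \<phi> z)"
    by (intro sums_diff sums_times_deriv d z)
  \<comment> \<open>Shifting back by 2 leaves the sum unchanged, as the two dropped terms are
    zero.\<close>
  then have "(\<lambda>n. of_nat (n + 2) * d (n + 2) * z ^ (n + 2) - d (n + 2) * z ^ (n + 2))
      sums (z * deriv \<phi> z - \<phi> z)"
    by (subst sums_iff_shift) (simp add: d_def numeral_2_eq_2)
  then show ?thesis
    by (simp add: d_def algebra_simps)
qed

text \<open>Each power of \<open>z\<close> has modulus at most 1 on the disc, so the terms are
  dominated by a summable series that does not depend on \<open>z\<close>.\<close>

lemma norm_minus_times_deriv_le:
  fixes c :: "nat \<Rightarrow> complex"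
  assumes sums: "\<And>w. w \<in> ball 0 1 \<Longrightarrow> (\<lambda>n. c (n + 2) * w ^ (n + 2)) sums \<phi> w"
    and summ: "summable (\<lambda>n. real (n + 1) * cmod (c (n + 2)))"
    and z: "z \<in> ball 0 1"
  shows "cmod (\<phi> z - z * deriv \<phi> z) \<le> (\<Sum>n. real (n + 1) * cmod (c (n + 2)))"
proof -
  have "cmod (of_nat (n + 1) * c (n + 2) * z ^ (n + 2)) \<le> real (n + 1) * cmod (c (n + 2))" for n
    unfolding norm_mult norm_power norm_of_nat
    using z by (intro mult_left_le power_le_one) auto
  then have "cmod (\<Sum>n. of_nat (n + 1) * c (n + 2) * z ^ (n + 2))
      \<le> (\<Sum>n. real (n + 1) * cmod (c (n + 2)))"
    by (rule norm_suminf_le[OF _ summ])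
  then show ?thesis
    by (subst norm_minus_commute)
      (simp only: sums_unique[OF sums_times_deriv_minus[OF sums z], symmetric])
qed

theorem theorem2p3:
  fixes l :: real and f h g :: "complex \<Rightarrow> complex" and a b :: "nat \<Rightarrow> complex"
  assumes "l > 0"
    and "f \<in> harmonic_H0"
    and "harmonic_rep f h g a b"
    and "summable (\<lambda>n. (real (n + 2) - 1) * (cmod (a (n + 2)) + cmod (b (n + 2))))"
    and "(\<Sum>n. (real (n + 2) - 1) * (cmod (a (n + 2)) + cmod (b (n + 2)))) < l"
  shows "f \<in> Omega_H0 l"
proof -
  let ?A = "\<lambda>n. real (n + 1) * cmod (a (n + 2))" and ?B = "\<lambda>n. real (n + 1) * cmod (b (n + 2))"
  have AB: "(real (n + 2) - 1) * (cmod (a (n + 2)) + cmod (b (n + 2))) = ?A n + ?B n" for n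
    by (simp add: algebra_simps)
  have summ: "summable (\<lambda>n. ?A n + ?B n)" and less: "(\<Sum>n. ?A n + ?B n) < l"
    using assms(4,5) unfolding AB by simp_all
  \<comment> \<open>Both halves are nonnegative, so each is dominated by their summable sum.\<close>
  have A: "summable ?A"
    by (rule summable_comparison_test'[OF summ, of 0]) simp
  have B: "summable ?B"
    by (rule summable_comparison_test'[OF summ, of 0]) simp
  have h: "h holomorphic_on ball 0 1"
    and a: "\<And>z. z \<in> ball 0 1 \<Longrightarrow> (\<lambda>n. a (n + 2) * z ^ (n + 2)) sums (h z - z)"
    and b: "\<And>z. z \<in> ball 0 1 \<Longrightarrow> (\<lambda>n. b (n + 2) * z ^ (n + 2)) sums g z"
    using assms(3) by (auto simp: harmonic_rep_def analytic_imp_holomorphic)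
  have "cmod (h z - z * deriv h z) < l - cmod (g z - z * deriv g z)" if z: "z \<in> ball 0 1" for z
  proof -
    have "h field_differentiable at z"
      using h z by (metis holomorphic_on_imp_differentiable_at open_ball)
    \<comment> \<open>The bound needs a series that starts at degree 2, so it is applied to
      \<open>h w - w\<close>; the linear term adds \<open>z\<close> to both \<open>h z\<close> and
      \<open>z * deriv h z\<close> and cancels.\<close>
    then have deriv_h: "deriv h z = deriv (\<lambda>w. h w - w) z + 1"
      by simp
    have "h z - z * deriv h z = (h z - z) - z * deriv (\<lambda>w. h w - w) z"
      by (simp add: deriv_h algebra_simps)
    then have "cmod (h z - z * deriv h z) \<le> suminf ?A"
      using norm_minus_times_deriv_le[OF a A z] by (simp only:)
    moreover have "cmod (g z - z * deriv g z) \<le> suminf ?B"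
      by (rule norm_minus_times_deriv_le[OF b B z])
    moreover have "suminf ?A + suminf ?B < l"
      using less suminf_add[OF A B] by simp
    ultimately show ?thesis
      by linarith
  qed
  then show ?thesis
    using assms(2,3) unfolding Omega_H0_def by blast
qed

end
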